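(* Let $s,t$ be real numbers with $s\neq0$, $t\neq0$. For every positive integer $n$: (1) $\genfrac{\{}{\}}{0pt}{}{n+2}{2}_{s,t}=t\genfrac{\{}{\}}{0pt}{}{n+1}{2}_{s,t}+\{n+1\}_{s,t}^2$; (2) $\varphi_{s,t}^{n+1}\genfrac{\{}{\}}{0pt}{}{n}{2}_{s,t}+\varphi_{s,t}^{\prime\,(n-1)}\genfrac{\{}{\}}{0pt}{}{n+1}{2}_{s,t}=\frac{\langle n\rangle_{s,t}}{\{2\}_{s,t}}\{n\}_{s,t}^2$, where $\langle n\rangle_{s,t}=\varphi_{s,t}^n+\varphi_{s,t}^{\prime\,n}$; (3) $\genfrac{\{}{\}}{0pt}{}{n+1}{2}_{s,t}=\sum_{k=1}^{n}t^{n-k}\{k\}_{s,t}^2$.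
   Context: The generalized Fibonacci polynomials $\{n\}_{s,t}$ are defined by $\{0\}_{s,t}=0$, $\{1\}_{s,t}=1$, $\{n+2\}_{s,t}=s\{n+1\}_{s,t}+t\{n\}_{s,t}$ (so $\{2\}_{s,t}=s$). Set $\varphi_{s,t}=\frac{s+\sqrt{s^2+4t}}{2}$ and $\varphi'_{s,t}=\frac{s-\sqrt{s^2+4t}}{2}$; exponents on $\varphi'_{s,t}$ denote ordinary powers. The generalized triangular numbers are $\genfrac{\{}{\}}{0pt}{}{m}{2}_{s,t}=\frac{\{m-1\}_{s,t}\{m\}_{s,t}}{\{2\}_{s,t}}$ for integers $m\geq1$. *)

theory Defs
  imports Complex_Main
begin

fun gfib :: "real \<Rightarrow> real \<Rightarrow> nat \<Rightarrow> real" where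
  "gfib s t 0 = 0"
| "gfib s t (Suc 0) = 1"
| "gfib s t (Suc (Suc n)) = s * gfib s t (Suc n) + t * gfib s t n"

text \<open>The discriminant \<open>s\<^sup>2 + 4 * t\<close> may be negative, so the two roots are complex numbers,
  formed with the principal square root; for a nonnegative discriminant this is the real
  square root.\<close>

definition phi :: "real \<Rightarrow> real \<Rightarrow> complex" where
  "phi s t = (of_real s + csqrt (of_real (s\<^sup>2 + 4 * t))) / 2"

definition phi' :: "real \<Rightarrow> real \<Rightarrow> complex" where
  "phi' s t = (of_real s - csqrt (of_real (s\<^sup>2 + 4 * t))) / 2"

definition gluc :: "real \<Rightarrow> real \<Rightarrow> nat \<Rightarrow> complex" where
  "gluc s t n = phi s t ^ n + phi' s t ^ n"

text \<open>Meaningful for \<open>m \<ge> 1\<close> only, because of the truncated subtraction \<open>m - 1\<close>.\<close>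

definition gtri :: "real \<Rightarrow> real \<Rightarrow> nat \<Rightarrow> real" where
  "gtri s t m = gfib s t (m - 1) * gfib s t m / gfib s t 2"

end

theory Submission
  imports Defs
begin

text \<open>The first identity is the recurrence multiplied by \<open>{n+1}\<close>, and the third one iterates it.
  For the second one, let \<open>a\<close> and \<open>b\<close> be the two roots. Each root splits off the recurrence a
  geometric sequence in the other root: \<open>{n+1} = a {n} + b^n\<close> and \<open>{n+1} = b {n} + a^n\<close>.
  Unlike Binet's formula, this needs no division by \<open>a - b\<close>, hence covers a zero discriminant.\<close>

lemma phi_add: "phi s t + phi' s t = of_real s"
  by (simp add: phi_def phi'_def field_simps)

lemma phi_mult: "phi s t * phi' s t = - of_real t"
proof -
  let ?r = "csqrt (of_real (s\<^sup>2 + 4 * t))"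
  have "phi s t * phi' s t = ((of_real s)\<^sup>2 - ?r\<^sup>2) / 4"
    unfolding phi_def phi'_def by (simp add: algebra_simps power2_eq_square)
  also have "\<dots> = - of_real t"
    \<comment> \<open>The principal root squares back to the discriminant whatever its sign, so no
      case split arises.\<close>
    unfolding power2_csqrt by simp
  finally show ?thesis .
qed

text \<open>Only the sum and product of \<open>a\<close> and \<open>b\<close> enter, so the roots
  can be inserted in either order.\<close>

lemma gfib_Suc_root:
  fixes a b :: complex
  assumes "a + b = of_real s" and "a * b = - of_real t"
  shows "of_real (gfib s t (Suc n)) = a * of_real (gfib s t n) + b ^ n"
proof (induction n)
  case 0
  then show ?case by simp
next
  case (Suc n)
  have t: "of_real t = - (a * b)"
    using assms(2) by simp
  have "of_real (gfib s t (Suc (Suc n)))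
      = (a + b) * of_real (gfib s t (Suc n)) - a * b * of_real (gfib s t n)"
    by (simp add: assms(1) t)
  \<comment> \<open>By induction, \<open>b\<close> times {n+1} exceeds \<open>a * b\<close> times
    {n} by exactly \<open>b ^ Suc n\<close>.\<close>
  also have "\<dots> = a * of_real (gfib s t (Suc n)) + b ^ Suc n"
    by (simp add: Suc.IH algebra_simps)
  finally show ?case .
qed

lemma gfib_2: "gfib s t 2 = s"
  by (simp add: numeral_2_eq_2)

lemma gtri_Suc_Suc:
  assumes "s \<noteq> 0"
  shows "gtri s t (Suc (Suc n)) = t * gtri s t (Suc n) + (gfib s t (Suc n))\<^sup>2"
  using assms by (simp add: gtri_def gfib_2 field_simps power2_eq_square)

lemma gtri_Suc_eq_sum:
  assumes "s \<noteq> 0"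
  shows "gtri s t (Suc n) = (\<Sum>k = 1..n. t ^ (n - k) * (gfib s t k)\<^sup>2)"
proof (induction n)
  case 0
  then show ?case by (simp add: gtri_def)
next
  case (Suc n)
  \<comment> \<open>The factor \<open>t\<close> raises every exponent by one; the new summand
    \<open>k = Suc n\<close> has exponent 0 and is the square from the recurrence.\<close>
  have "t * (\<Sum>k = 1..n. t ^ (n - k) * (gfib s t k)\<^sup>2)
      = (\<Sum>k = 1..n. t ^ (Suc n - k) * (gfib s t k)\<^sup>2)"
    unfolding sum_distrib_left by (intro sum.cong) (auto simp: Suc_diff_le)
  then show ?case
    by (simp add: gtri_Suc_Suc[OF assms] Suc.IH)
qed

text \<open>This is the second identity for n = m + 1, stripped of the factor {m+1}/s that both
  triangular numbers share.\<close>

lemma phi_gfib_identity: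
  "phi s t ^ (m + 2) * of_real (gfib s t m) + phi' s t ^ m * of_real (gfib s t (m + 2))
    = gluc s t (m + 1) * of_real (gfib s t (m + 1))"
proof -
  define a b where "a = phi s t" and "b = phi' s t"
  have ab: "a + b = of_real s" "a * b = - of_real t"
    by (simp_all add: a_def b_def phi_add phi_mult)
  then have ba: "b + a = of_real s" "b * a = - of_real t"
    by (simp_all add: add.commute mult.commute)
  define x where "x = complex_of_real (gfib s t m)"
  have y: "of_real (gfib s t (m + 1)) = a * x + b ^ m"
    using gfib_Suc_root[OF ab, of m] by (simp add: x_def)
  \<comment> \<open>With the roots swapped, the new term \<open>a ^ (m + 1)\<close> times
    \<open>b ^ m\<close> joins \<open>a ^ (m + 2) * x\<close> to give \<open>a ^ (m + 1)\<close>
    times {m+1}.\<close>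
  have z: "of_real (gfib s t (m + 2)) = b * (a * x + b ^ m) + a ^ (m + 1)"
    using gfib_Suc_root[OF ba, of "Suc m"] y by simp
  show ?thesis
    unfolding gluc_def a_def[symmetric] b_def[symmetric] x_def[symmetric] y z
    by (simp add: algebra_simps)
qed

lemma phi_gtri_identity:
  assumes "s \<noteq> 0"
  shows "phi s t ^ (m + 2) * of_real (gtri s t (m + 1)) + phi' s t ^ m * of_real (gtri s t (m + 2))
    = gluc s t (m + 1) / of_real (gfib s t 2) * (of_real (gfib s t (m + 1)))\<^sup>2"
proof -
  let ?y = "complex_of_real (gfib s t (m + 1))"
  have "phi s t ^ (m + 2) * of_real (gtri s t (m + 1)) + phi' s t ^ m * of_real (gtri s t (m + 2))
    = (phi s t ^ (m + 2) * of_real (gfib s t m) + phi' s t ^ m * of_real (gfib s t (m + 2)))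
      * ?y / of_real s"
    using assms by (simp add: gtri_def gfib_2 field_simps del: gfib.simps)
  also have "\<dots> = gluc s t (m + 1) / of_real (gfib s t 2) * ?y\<^sup>2"
    unfolding phi_gfib_identity by (simp add: gfib_2 power2_eq_square)
  finally show ?thesis .
qed

theorem theorem2:
  fixes s t :: real and n :: nat
  assumes "s \<noteq> 0" and "t \<noteq> 0" and "n \<ge> 1"
  shows "gtri s t (n + 2) = t * gtri s t (n + 1) + (gfib s t (n + 1))\<^sup>2 \<and>
    phi s t ^ (n + 1) * of_real (gtri s t n) + phi' s t ^ (n - 1) * of_real (gtri s t (n + 1))
      = gluc s t n / of_real (gfib s t 2) * (of_real (gfib s t n))\<^sup>2 \<and>
    gtri s t (n + 1) = (\<Sum>k = 1..n. t ^ (n - k) * (gfib s t k)\<^sup>2)"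
proof (intro conjI)
  show "gtri s t (n + 2) = t * gtri s t (n + 1) + (gfib s t (n + 1))\<^sup>2"
    using gtri_Suc_Suc[OF assms(1)] by simp
  \<comment> \<open>This turns the truncated exponent \<open>n - 1\<close> into
    \<open>m\<close>.\<close>
  obtain m where "n = m + 1"
    using assms(3) by (metis le_add_diff_inverse2)
  then show "phi s t ^ (n + 1) * of_real (gtri s t n)
      + phi' s t ^ (n - 1) * of_real (gtri s t (n + 1))
      = gluc s t n / of_real (gfib s t 2) * (of_real (gfib s t n))\<^sup>2"
    using phi_gtri_identity[OF assms(1), where m = m] by (simp del: gfib.simps)
  show "gtri s t (n + 1) = (\<Sum>k = 1..n. t ^ (n - k) * (gfib s t k)\<^sup>2)"
    using gtri_Suc_eq_sum[OF assms(1)] by simp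
qed

end
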